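(* Let $(\mathbb{K},|\cdot|)$ be a non-Archimedean field and let $(X,\|\cdot\|)$ be a non-zero non-Archimedean normed space over $\mathbb{K}$ that is strictly convex. Then $X$ is linearly isometric to $\mathbb{Z}/3\mathbb{Z}$ endowed with the norm $\|0\|=0$, $\|-1\|=\|1\|=\lambda$, for some $\lambda\in(0,\infty)$. That is, the field $\mathbb{K}$ is isomorphic to $\mathbb{Z}/3\mathbb{Z}$ and, identifying $\mathbb{K}$ with $\mathbb{Z}/3\mathbb{Z}$, there exist $\lambda\in(0,\infty)$ and a bijective $\mathbb{Z}/3\mathbb{Z}$-linear map $T:X\to\mathbb{Z}/3\mathbb{Z}$ such that $\|x\|=\|T(x)\|$ for all $x\in X$, where $\mathbb{Z}/3\mathbb{Z}$ carries the norm just described.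
   Context: A non-Archimedean field is a field $\mathbb{K}$ equipped with a function $|\cdot|:\mathbb{K}\to[0,\infty)$ such that, for all $r,s\in\mathbb{K}$: $|r|=0$ if and only if $r=0$; $|rs|=|r||s|$; $|r+s|\le\max\{|r|,|s|\}$. (The trivial valuation is allowed; on a finite field it is the only one.) A non-Archimedean normed space over $(\mathbb{K},|\cdot|)$ is a $\mathbb{K}$-linear space $X$ endowed with a function $\|\cdot\|:X\to[0,\infty)$ such that, for all $x,y\in X$ and $r\in\mathbb{K}$: $\|x\|=0$ if and only if $x=0$; $\|rx\|=|r|\|x\|$; $\|x+y\|\le\max\{\|x\|,\|y\|\}$. A non-Archimedean normed space $X$ over $(\mathbb{K},|\cdot|)$ is strictly convex if (SC1) the valuation of $\mathbb{K}$ satisfies $|2|=1$, and (SC2) for all $x,y\in X$, $\|x+y\|=\max\{\|x\|,\|y\|\}$ and $\|x\|=\|y\|$ imply $x=y$. *)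

theory Defs
  imports Complex_Main "HOL-Library.Numeral_Type"
begin

locale nonarch_field =
  fixes val :: "'k::field \<Rightarrow> real"
  assumes val_nonneg: "0 \<le> val r"
    and val_eq_0_iff: "val r = 0 \<longleftrightarrow> r = 0"
    and val_mult: "val (r * s) = val r * val s"
    and val_add_le: "val (r + s) \<le> max (val r) (val s)"

locale nonarch_normed_space =
  nonarch_field val + vector_space scale
  for val :: "'k::field \<Rightarrow> real"
    and scale :: "'k \<Rightarrow> 'x::ab_group_add \<Rightarrow> 'x"
    and nrm :: "'x \<Rightarrow> real" +
  assumes nrm_nonneg: "0 \<le> nrm x"
    and nrm_eq_0_iff: "nrm x = 0 \<longleftrightarrow> x = 0"
    and nrm_scale: "nrm (scale r x) = val r * nrm x"
    and nrm_add_le: "nrm (x + y) \<le> max (nrm x) (nrm y)"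

definition strictly_convex :: "('k::field \<Rightarrow> real) \<Rightarrow> ('x::ab_group_add \<Rightarrow> real) \<Rightarrow> bool"
  where "strictly_convex val nrm \<longleftrightarrow>
    val 2 = 1 \<and>
    (\<forall>x y. nrm (x + y) = max (nrm x) (nrm y) \<and> nrm x = nrm y \<longrightarrow> x = y)"

definition ring_isomorphism :: "('a::comm_ring_1 \<Rightarrow> 'b::comm_ring_1) \<Rightarrow> bool"
  where "ring_isomorphism \<phi> \<longleftrightarrow>
    bij \<phi> \<and> \<phi> 1 = 1 \<and>
    (\<forall>r s. \<phi> (r + s) = \<phi> r + \<phi> s) \<and>
    (\<forall>r s. \<phi> (r * s) = \<phi> r * \<phi> s)"

text \<open>The numeral type \<^typ>\<open>3\<close> has three elements and arithmetic modulo 3; it serves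
  as the ring of integers modulo 3.\<close>

definition nrm3 :: "real \<Rightarrow> 3 \<Rightarrow> real"
  where "nrm3 l a = (if a = 0 then 0 else l)"

lemma nrm3_simps [simp]: "nrm3 l 0 = 0" "nrm3 l 1 = l" "nrm3 l (- 1) = l"
  by (simp_all add: nrm3_def)

end

theory Submission
  imports Defs
begin

text \<open>Let \<open>u \<noteq> 0\<close>. The vectors \<open>u\<close> and \<open>-2u\<close> have the same norm as their sum \<open>-u\<close>, so
  \<open>3u = 0\<close>. If \<open>v\<close> has the same norm as \<open>u\<close> but differs from it, then \<open>u + v\<close> is strictly shorter
  than \<open>2v\<close>, so \<open>u - v = (u + v) - 2v\<close> has the same norm as \<open>u\<close> and \<open>-v\<close>, whence \<open>u = -v\<close>.
  If \<open>v\<close> is strictly shorter than \<open>u\<close>, then \<open>u\<close>, \<open>u + v\<close> and \<open>2u + v\<close> have the same norm, whence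
  \<open>v = 0\<close>. So the space consists of \<open>0\<close>, \<open>u\<close> and \<open>-u\<close>, and comparing multiples of \<open>u\<close> the field
  consists of \<open>0\<close>, \<open>1\<close> and \<open>-1\<close>.\<close>

context nonarch_field
begin

lemma val_one: "val 1 = 1"
  using val_mult[of 1 1] val_eq_0_iff[of 1] by simp

lemma val_minus_one: "val (- 1) = 1"
proof -
  have "val (- 1) * val (- 1) = 1"
    using val_mult[of "- 1" "- 1"] val_one by simp
  then show ?thesis
    using val_nonneg[of "- 1"] by (metis abs_of_nonneg abs_mult_self_eq real_sqrt_abs2 real_sqrt_one)
qed

end

context nonarch_normed_space
begin

lemma nrm_zero [simp]: "nrm 0 = 0"
  by (simp add: nrm_eq_0_iff)

lemma nrm_minus [simp]: "nrm (- x) = nrm x"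
  using nrm_scale[of "- 1" x] by (simp add: val_minus_one)

text \<open>Writing \<open>x\<close> as \<open>(x + y) - y\<close> bounds \<open>nrm x\<close> by
  the larger of \<open>nrm (x + y)\<close> and \<open>nrm y\<close>, and the second is too
  small.\<close>

lemma nrm_add_eq:
  assumes "nrm y < nrm x"
  shows "nrm (x + y) = nrm x"
  using nrm_add_le[of x y] nrm_add_le[of "x + y" "- y"] assms by auto

lemma scale_two: "scale 2 x = x + x"
  using scale_left_distrib[of 1 1 x] by simp

context
  assumes strictly_convex: "strictly_convex val nrm"
begin

lemma nrm_double: "nrm (x + x) = nrm x"
  using nrm_scale[of 2 x] strictly_convex by (simp add: scale_two strictly_convex_def)

lemma eq_if_nrm_add_eq:
  assumes "nrm x = nrm y" "nrm (x + y) = nrm x"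
  shows "x = y"
  using strictly_convex assms by (simp add: strictly_convex_def)

lemma double_eq_minus: "x + x = - (x :: 'x)"
proof -
  have "x = - (x + x)"
    by (rule eq_if_nrm_add_eq) (simp_all only: nrm_minus nrm_double, simp)
  then show ?thesis by (metis minus_minus)
qed

lemma eq_zero_if_nrm_less:
  assumes "nrm y < nrm x"
  shows "y = 0"
proof -
  have "nrm (x + (x + y)) = nrm x"
    using nrm_add_eq[of y "x + x"] assms by (simp add: nrm_double add.assoc)
  then have "x = x + y"
    by (intro eq_if_nrm_add_eq) (simp_all add: nrm_add_eq assms)
  then show ?thesis by simp
qed

lemma eq_or_eq_minus_if_nrm_eq:
  assumes "nrm x = nrm y"
  shows "x = y \<or> x = - y"
proof (cases "x = y")
  case False
  then have "nrm (x + y) < nrm y"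
    using eq_if_nrm_add_eq[of x y] nrm_add_le[of x y] assms by fastforce
  then have "nrm (- (y + y) + (x + y)) = nrm y"
    by (subst nrm_add_eq) (simp_all only: nrm_minus nrm_double)
  then have "nrm (x + - y) = nrm x"
    by (simp add: assms)
  then have "x = - y"
    by (intro eq_if_nrm_add_eq) (simp_all add: assms)
  then show ?thesis ..
qed simp

lemma vector_cases:
  fixes u x :: 'x
  assumes "u \<noteq> 0"
  shows "x = 0 \<or> x = u \<or> x = - u"
  \<comment> \<open>Compare \<open>nrm x\<close> with \<open>nrm u\<close>: if they differ, the
    shorter vector is 0, and it cannot be \<open>u\<close>.\<close>
  using eq_zero_if_nrm_less[of x u] eq_zero_if_nrm_less[of u x] eq_or_eq_minus_if_nrm_eq[of x u] assms
  by linarith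

lemma scalar_cases:
  fixes r :: 'k and u :: 'x
  assumes "u \<noteq> 0"
  shows "r = 0 \<or> r = 1 \<or> r = - 1"
proof -
  have "scale r u = scale 0 u \<or> scale r u = scale 1 u \<or> scale r u = scale (- 1) u"
    using vector_cases[OF assms, of "scale r u"] by simp
  then show ?thesis
    using assms by (simp only: scale_cancel_right simp_thms)
qed

lemma one_add_one:
  fixes u :: 'x
  assumes "u \<noteq> 0"
  shows "(1 :: 'k) + 1 = - 1"
proof -
  have "scale (1 + 1) u = scale (- 1) u"
    using double_eq_minus[of u] by (simp only: scale_left_distrib scale_one scale_minus_left)
  then show ?thesis
    using assms by (simp only: scale_cancel_right simp_thms)
qed

end

end

lemma mod3_one_neq_minus_one: "(1 :: 3) \<noteq> - 1"
  by simp

text \<open>Three distinct elements exhaust a type of cardinality three.\<close>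

lemma mod3_cases: "(a :: 3) = 0 \<or> a = 1 \<or> a = - 1"
proof -
  have "card {0, 1, - 1 :: 3} = card (UNIV :: 3 set)"
    using mod3_one_neq_minus_one by simp
  then have "{0, 1, - 1 :: 3} = UNIV"
    by (intro card_subset_eq) simp_all
  then show ?thesis by blast
qed

text \<open>Meant for a group consisting of \<open>0\<close>, \<open>u\<close> and
  \<open>- u\<close>. The group is left abstract so that the same lemmas serve the field, with
  \<open>u = 1\<close>, and the space.\<close>

definition mod3_coord :: "'a::ab_group_add \<Rightarrow> 'a \<Rightarrow> 3"
  where "mod3_coord u x = (if x = 0 then 0 else if x = u then 1 else - 1)"

context
  fixes u :: "'a::ab_group_add"
  assumes nonzero: "u \<noteq> 0"
    and double: "u + u = - u"
    and exhaust: "\<And>x. x = 0 \<or> x = u \<or> x = - u"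
begin

text \<open>From \<open>- u = u\<close> and \<open>double\<close> would follow
  \<open>u + u = u\<close>, hence \<open>u = 0\<close>.\<close>

lemma minus_neq: "- u \<noteq> u"
  using nonzero double by (metis add_cancel_right_right)

lemma mod3_coord_simps [simp]:
  "mod3_coord u 0 = 0" "mod3_coord u u = 1" "mod3_coord u (- u) = - 1"
  using nonzero minus_neq by (simp_all add: mod3_coord_def)

lemma mod3_coord_minus: "mod3_coord u (- x) = - mod3_coord u x"
  using exhaust[of x] by auto

lemma mod3_coord_add: "mod3_coord u (x + y) = mod3_coord u x + mod3_coord u y"
proof -
  have minus_double: "- u + - u = u"
    using double by (metis minus_add_distrib minus_minus)
  show ?thesis
    using exhaust[of x] exhaust[of y]
    by (elim disjE) (simp_all add: double minus_double[simplified])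
qed

lemma bij_mod3_coord: "bij (mod3_coord u)"
proof (rule bijI)
  show "inj (mod3_coord u)"
  proof (rule injI)
    fix x y
    assume "mod3_coord u x = mod3_coord u y"
    then show "x = y"
      using exhaust[of x] exhaust[of y] mod3_one_neq_minus_one by auto
  qed
  show "surj (mod3_coord u)"
    unfolding surj_def using mod3_cases mod3_coord_simps by metis
qed

end

theorem lemma2p8:
  fixes val :: "'k::field \<Rightarrow> real"
    and scale :: "'k \<Rightarrow> 'x::ab_group_add \<Rightarrow> 'x"
    and nrm :: "'x \<Rightarrow> real"
  assumes "nonarch_normed_space val scale nrm"
    and "\<exists>x::'x. x \<noteq> 0"
    and "strictly_convex val nrm"
  shows "\<exists>\<phi> :: 'k \<Rightarrow> 3. ring_isomorphism \<phi> \<and>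
    (\<exists>l>0. \<exists>T :: 'x \<Rightarrow> 3.
      bij T \<and>
      module_hom (\<lambda>a. scale (inv \<phi> a)) (*) T \<and>
      (\<forall>x. nrm x = nrm3 l (T x)))"
proof -
  interpret nonarch_normed_space val scale nrm by fact
  obtain u :: 'x where u: "u \<noteq> 0"
    using assms(2) by blast
  \<comment> \<open>Each of the two triples supplies, in order, the hypotheses
    \<open>nonzero\<close>, \<open>double\<close> and \<open>exhaust\<close> behind the lemmas on
    \<open>mod3_coord\<close>.\<close>
  note vectors = u double_eq_minus[OF assms(3)] vector_cases[OF assms(3) u]
  note scalars = one_neq_zero one_add_one[OF assms(3) u] scalar_cases[OF assms(3) u]
  define \<phi> where "\<phi> = mod3_coord (1 :: 'k)"
  define T where "T = mod3_coord u"
  note T_simps = mod3_coord_simps[OF vectors, folded T_def]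
    and T_minus = mod3_coord_minus[OF vectors, folded T_def]
    and T_add = mod3_coord_add[OF vectors, folded T_def]
  note phi_simps = mod3_coord_simps[OF scalars, folded \<phi>_def]
    and phi_minus = mod3_coord_minus[OF scalars, folded \<phi>_def]
    and phi_add = mod3_coord_add[OF scalars, folded \<phi>_def]
    and phi_bij = bij_mod3_coord[OF scalars, folded \<phi>_def]
  \<comment> \<open>Multiplying by 0, 1 or -1 is zero, identity or negation, which
    \<open>\<phi>\<close> respects; \<open>T_scale\<close> holds for the same reason.\<close>
  have phi_mult: "\<phi> (r * s) = \<phi> r * \<phi> s" for r s
    using scalars(3)[of r] by (elim disjE) (simp_all add: phi_simps phi_minus)
  have T_scale: "T (scale r x) = \<phi> r * T x" for r x
    using scalars(3)[of r] by (elim disjE) (simp_all add: T_simps T_minus phi_simps)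
  have phi_inv: "\<phi> (inv \<phi> a) = a" for a
    using phi_bij by (simp add: bij_is_surj surj_f_inv_f)
  \<comment> \<open>Turns equations about \<open>inv \<phi>\<close> into equations about
    \<open>\<phi>\<close>, so that the inverse inherits the ring laws.\<close>
  have inv_phi: "inv \<phi> a = r \<longleftrightarrow> a = \<phi> r" for a r
    using phi_bij phi_inv by (metis bij_is_inj inv_f_f)
  have "ring_isomorphism \<phi>"
    unfolding ring_isomorphism_def using phi_bij phi_simps phi_add phi_mult by blast
  moreover have "module_hom (\<lambda>a. scale (inv \<phi> a)) (*) T"
  proof unfold_locales
    fix a b :: 3 and x y :: 'x
    have "inv \<phi> (a + b) = inv \<phi> a + inv \<phi> b"
      by (simp add: inv_phi phi_add phi_inv)
    then show "scale (inv \<phi> (a + b)) x = scale (inv \<phi> a) x + scale (inv \<phi> b) x"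
      by (simp add: scale_left_distrib)
    have "inv \<phi> (a * b) = inv \<phi> a * inv \<phi> b"
      by (simp add: inv_phi phi_mult phi_inv)
    then show "scale (inv \<phi> a) (scale (inv \<phi> b) x) = scale (inv \<phi> (a * b)) x"
      by simp
    have "inv \<phi> 1 = 1"
      by (simp add: inv_phi phi_simps)
    then show "scale (inv \<phi> 1) x = x"
      by simp
  qed (simp_all add: T_add T_scale phi_inv scale_right_distrib algebra_simps)
  \<comment> \<open>Every nonzero vector is \<open>u\<close> or \<open>- u\<close>, so
    \<open>nrm u\<close> serves as \<open>l\<close>.\<close>
  moreover have "nrm x = nrm3 (nrm u) (T x)" for x
    using vectors(3)[of x] by (elim disjE) (simp_all add: T_simps)
  moreover have "nrm u > 0"
    using u nrm_nonneg[of u] nrm_eq_0_iff[of u] by linarith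
  moreover have "bij T"
    using bij_mod3_coord[OF vectors, folded T_def] .
  ultimately show ?thesis by blast
qed

end
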